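(* Let $\{X_i\}_{i\ge1}$ be a Bernoulli sequence with random dependence (BSRD) whose memory switch sequence $\{Y_i\}_{i\ge1}$ is i.i.d. Bernoulli with parameter $\lambda\in[0,1]$, and whose conditional probabilities are $$P_i(s,y)=(1-\beta)\alpha_0+\beta y\frac{s}{i},\qquad i\ge1,\ 0\le s\le i,\ y\in\{0,1\},$$ where $0\le\beta\le1$ and $\alpha_0=\mathbb{P}(X_1=1)$. Let $S_n=X_1+\cdots+X_n$. (i) If $\beta\lambda<1/2$, then as $n\to\infty$ $$\frac{1}{\sqrt n}\left(S_n-\frac{n\alpha_0(1-\beta)}{1-\beta\lambda}\right)\xrightarrow{d}N(0,\sigma^2),\qquad \sigma^2=\frac{\alpha_0\big(1-\alpha_0-\beta(\lambda-\alpha_0)\big)(1-\beta)}{(1-2\beta\lambda)(1-\beta\lambda)^2}.$$ (ii) If $\beta\lambda=1/2$, then as $n\to\infty$ $$\frac{S_n-2n\alpha_0(1-\beta)}{\sqrt{n\log n}}\xrightarrow{d}N(0,\sigma^2),\qquad \sigma^2=4\alpha_0\left(\tfrac12-\alpha_0(1-\beta)\right)(1-\beta).$$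
   Context: BSRD. $\{X_i\}_{i\ge1}$ is a sequence of $\{0,1\}$-valued random variables, $S_i=X_1+\cdots+X_i$, and $\{Y_i\}_{i\ge1}$ (the memory switch sequence) is a sequence of independent $\{0,1\}$-valued random variables, with $Y_i$ independent of $S_i$ for every $i\ge1$. Put $\mathcal{F}_i=\sigma(X_1,\dots,X_i)$ and $\mathcal{F}^Y_i=\sigma(Y_1,\dots,Y_i)$. The past enters only through $S_i$ and $Y_i$: $\mathbb{P}(X_{i+1}=1\mid\mathcal{F}_i,\mathcal{F}^Y_i)=\mathbb{P}(X_{i+1}=1\mid S_i,Y_i)$ and $\mathbb{P}(X_{i+1}=1\mid\mathcal{F}_i)=\mathbb{P}(X_{i+1}=1\mid S_i)$. Write $P_i(s,y)=\mathbb{P}(X_{i+1}=1\mid S_i=s,Y_i=y)$. (For the conditional probabilities in the claim, this gives $\mathbb{P}(X_{i+1}=1\mid S_i=s)=(1-\beta)\alpha_0+\lambda\beta\frac{s}{i}$.) $\xrightarrow{d}$ denotes convergence in distribution; $N(0,\sigma^2)$ is the normal law with mean $0$ and variance $\sigma^2$ (the point mass at $0$ if $\sigma^2=0$). *)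

theory Defs
  imports "HOL-Probability.Probability"
begin

definition partial_sum :: "(nat \<Rightarrow> 'a \<Rightarrow> nat) \<Rightarrow> nat \<Rightarrow> 'a \<Rightarrow> nat" where
  "partial_sum X n \<omega> = (\<Sum>i=1..n. X i \<omega>)"

text \<open>The sigma-algebra on the space of \<open>M\<close> generated by a family of discrete random variables.
  Only its space and its sets matter; conditional expectations take the measure from \<open>M\<close>.\<close>

definition generated_algebra :: "'a measure \<Rightarrow> ('a \<Rightarrow> nat) set \<Rightarrow> 'a measure" where
  "generated_algebra M Z = sigma (space M) {f -` A \<inter> space M | f A. f \<in> Z}"

text \<open>The conditional probability of the event \<open>P\<close> given a sub-sigma-algebra, as a random variable;
  it is determined up to a null set, so it is only ever compared almost everywhere.\<close>

definition cond_prob_algebra :: "'a measure \<Rightarrow> 'a measure \<Rightarrow> ('a \<Rightarrow> bool) \<Rightarrow> 'a \<Rightarrow> real" where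
  "cond_prob_algebra M F P = real_cond_exp M F (indicat_real {\<omega> \<in> space M. P \<omega>})"

text \<open>Bernoulli sequence with random dependence, \<open>Y\<close> being the memory switch sequence.
  Both sequences start at index 1; \<open>X 0\<close> and \<open>Y 0\<close> are irrelevant and unconstrained.\<close>

locale bsrd = prob_space M
  for M :: "'a measure" and X Y :: "nat \<Rightarrow> 'a \<Rightarrow> nat" +
  assumes X_measurable: "\<And>i. i \<ge> 1 \<Longrightarrow> X i \<in> M \<rightarrow>\<^sub>M count_space UNIV"
    and X_range: "\<And>i \<omega>. i \<ge> 1 \<Longrightarrow> \<omega> \<in> space M \<Longrightarrow> X i \<omega> \<in> {0, 1}"
    and Y_range: "\<And>i \<omega>. i \<ge> 1 \<Longrightarrow> \<omega> \<in> space M \<Longrightarrow> Y i \<omega> \<in> {0, 1}"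
    and Y_indep: "indep_vars (\<lambda>_. count_space UNIV) Y {1..}"
    and Y_indep_S:
      "\<And>i. i \<ge> 1 \<Longrightarrow> indep_var (count_space UNIV) (Y i) (count_space UNIV) (partial_sum X i)"
    and cond_XY: "\<And>i. i \<ge> 1 \<Longrightarrow>
      AE \<omega> in M.
        cond_prob_algebra M (generated_algebra M (X ` {1..i} \<union> Y ` {1..i})) (\<lambda>\<omega>. X (i + 1) \<omega> = 1) \<omega> =
        cond_prob_algebra M (generated_algebra M {partial_sum X i, Y i}) (\<lambda>\<omega>. X (i + 1) \<omega> = 1) \<omega>"
    and cond_X: "\<And>i. i \<ge> 1 \<Longrightarrow>
      AE \<omega> in M.
        cond_prob_algebra M (generated_algebra M (X ` {1..i})) (\<lambda>\<omega>. X (i + 1) \<omega> = 1) \<omega> =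
        cond_prob_algebra M (generated_algebra M {partial_sum X i}) (\<lambda>\<omega>. X (i + 1) \<omega> = 1) \<omega>"

text \<open>\<open>P\<^sub>i(s, y)\<close>. It is meaningful only if the conditioning event has positive probability;
  otherwise \<^const>\<open>cond_prob\<close> is a division by zero and returns \<open>0\<close>.\<close>

definition transition_prob ::
  "'a measure \<Rightarrow> (nat \<Rightarrow> 'a \<Rightarrow> nat) \<Rightarrow> (nat \<Rightarrow> 'a \<Rightarrow> nat) \<Rightarrow> nat \<Rightarrow> nat \<Rightarrow> nat \<Rightarrow> real" where
  "transition_prob M X Y i s y =
     cond_prob M (\<lambda>\<omega>. X (i + 1) \<omega> = 1) (\<lambda>\<omega>. partial_sum X i \<omega> = s \<and> Y i \<omega> = y)"

text \<open>The normal law with mean \<open>\<mu>\<close> and variance \<open>v\<close>, where \<open>v \<ge> 0\<close>. The second argument of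
  \<^const>\<open>normal_density\<close> is the standard deviation.\<close>

definition normal_law :: "real \<Rightarrow> real \<Rightarrow> real measure" where
  "normal_law \<mu> v =
     (if v = 0 then return borel \<mu> else density lborel (normal_density \<mu> (sqrt v)))"

end

theory Submission
  imports Defs "HOL-Real_Asymp.Real_Asymp"
begin

text \<open>
  Averaging the transition probabilities over the switch \<open>Y\<^sub>i\<close>, which is independent of \<open>S\<^sub>i\<close>, gives
  \<open>P(X\<^sub>i\<^sub>+\<^sub>1 = 1 | S\<^sub>i = s) = a + b s/i\<close> with \<open>a = (1 - \<beta>) \<alpha>\<^sub>0\<close> and \<open>b = \<beta> \<lambda>\<close>
  (\<open>bsrd_marginal_step\<close>). This alone determines the law of each \<open>S\<^sub>n\<close> from that of \<open>S\<^sub>1\<close>, and the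
  rest of the argument sees only these laws.

  Put \<open>\<mu> = a/(1 - b)\<close>, the fixed point of \<open>x \<mapsto> a + b x\<close>, and \<open>D\<^sub>i = S\<^sub>i - i \<mu>\<close>. Then
  \<open>D\<^sub>i\<^sub>+\<^sub>1 = (1 + b/i) D\<^sub>i + \<xi>\<close>, where given \<open>S\<^sub>i\<close> the variable \<open>\<xi>\<close> is a centred Bernoulli variable
  with parameter \<open>p = \<mu> + b D\<^sub>i/i\<close>. So \<open>D\<^sub>n/g\<^sub>n\<close> is a martingale for \<open>g\<^sub>n = (1 + b/1) \<dots> (1 + b/(n-1))\<close>,
  and its increments have conditional variance about \<open>\<mu>(1 - \<mu>)/g\<^sub>k\<^sub>+\<^sub>1\<^sup>2\<close>, because \<open>D\<^sub>i/i\<close> is small in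
  mean (\<open>abs_moment_bound\<close>).

  The central limit theorem for this martingale can be read off characteristic functions. One step
  multiplies the characteristic function of \<open>D\<^sub>i\<close> by \<open>exp (-u\<^sup>2 \<mu>(1 - \<mu>)/2)\<close>, up to an explicit
  error (\<open>\<psi>_step\<close>); since those factors are at most 1, the errors just add up (\<open>\<psi>_telescope\<close>). With
  weights \<open>w\<^sub>k = 1/g\<^sub>k\<^sub>+\<^sub>1\<^sup>2\<close> and \<open>W\<^sub>n = w\<^sub>1 + \<dots> + w\<^sub>n\<^sub>-\<^sub>1\<close>, the result for \<open>D\<^sub>n/g\<^sub>n\<close> at \<open>\<theta>\<close> is
  \<open>exp (-\<theta>\<^sup>2 W\<^sub>n \<mu>(1 - \<mu>)/2)\<close> with an error that is small relative to \<open>\<theta>\<^sup>2 W\<^sub>n\<close>.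

  It remains to compare \<open>W\<^sub>n\<close> with the normalisation \<open>C\<^sub>n\<close>, which is \<open>n\<close> or \<open>n log n\<close>. The quotient
  \<open>C\<^sub>n/g\<^sub>n\<^sup>2\<close> is \<open>C\<^sub>1\<close> plus the sum of the \<open>w\<^sub>k (C\<^sub>k\<^sub>+\<^sub>1 - C\<^sub>k (1 + b/k)\<^sup>2)\<close>, and the bracket converges to \<open>1 - 2b\<close> for
  \<open>C\<^sub>n = n\<close> and to \<open>1\<close> for \<open>C\<^sub>n = n log n\<close>, \<open>b = 1/2\<close>. As \<open>W\<^sub>n\<close> diverges for \<open>b \<le> 1/2\<close>, \<open>C\<^sub>n/(g\<^sub>n\<^sup>2 W\<^sub>n)\<close>
  is essentially a weighted mean of the brackets and has the same limit (\<open>weighted_Cesaro\<close>). Both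
  cases are therefore instances of one theorem, \<open>clt\<close>.
\<close>

section \<open>Characteristic functions of normal laws\<close>

lemma real_distribution_normal_law: "real_distribution (normal_law \<mu> v)" if "0 \<le> v"
proof (cases "v = 0")
  case True
  then show ?thesis
    by (auto simp: normal_law_def real_distribution_def real_distribution_axioms_def
        intro!: prob_space_return)
next
  case False
  then show ?thesis
    using that by (auto simp: normal_law_def real_distribution_def real_distribution_axioms_def
        intro!: prob_space_normal_density)
qed

lemma char_normal_law:
  assumes "0 \<le> v"
  shows "char (normal_law 0 v) t = complex_of_real (exp (- (v * t\<^sup>2) / 2))"
proof (cases "v = 0")
  case True
  then show ?thesis
    by (simp add: normal_law_def char_def integral_return)
next
  case False
  then have v: "0 < v" using assms by simp
  interpret N: prob_space "density lborel (normal_density 0 (sqrt v))"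
    using v by (intro prob_space_normal_density) simp
  have "distributed (density lborel (normal_density 0 (sqrt v))) lborel (\<lambda>x. x) (normal_density 0 (sqrt v))"
    by (auto simp: distributed_def distr_id2)
  then have "distributed (density lborel (normal_density 0 (sqrt v))) lborel
      (\<lambda>x. (x - 0) / sqrt v) std_normal_density"
    using N.normal_standard_normal_convert[of "sqrt v" "\<lambda>x. x" 0] v by simp
  then have eq: "std_normal_distribution = distr (density lborel (normal_density 0 (sqrt v))) lborel (\<lambda>x. x / sqrt v)"
    by (simp add: distributed_def)
  have "char (normal_law 0 v) t = (\<integral>x. iexp (t * sqrt v * (x / sqrt v)) \<partial>density lborel (normal_density 0 (sqrt v)))"
    using v by (simp add: normal_law_def char_def)
  also have "\<dots> = char std_normal_distribution (t * sqrt v)"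
    unfolding char_def by (subst eq, subst integral_distr) (auto simp: mult.assoc)
  finally show ?thesis
    using v by (simp add: char_std_normal_distribution power_mult_distrib mult.commute)
qed

section \<open>Weighted means and the growth factors\<close>

text \<open>Divergence of the total weight makes the weight of any initial segment negligible, so the
  weighted mean only sees the tail of the sequence.\<close>
lemma weighted_Cesaro:
  fixes w x :: "nat \<Rightarrow> real"
  assumes w: "\<And>k. 0 \<le> w k"
    and W: "filterlim (\<lambda>n. \<Sum>k=1..<n. w k) at_top sequentially"
    and x: "x \<longlonglongrightarrow> l"
  shows "(\<lambda>n. (\<Sum>k=1..<n. w k * x k) / (\<Sum>k=1..<n. w k)) \<longlonglongrightarrow> l"
proof (rule LIMSEQ_I)
  fix e :: real assume e: "0 < e"
  define W where "W n = (\<Sum>k=1..<n. w k)" for n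
  have Wtop: "filterlim W at_top sequentially" using W by (simp add: W_def[abs_def])
  obtain N where N: "\<And>k. k \<ge> N \<Longrightarrow> \<bar>x k - l\<bar> < e / 2"
    using LIMSEQ_D[OF x, of "e / 2"] e by auto
  define K where "K = (\<Sum>k=1..<N. w k * \<bar>x k - l\<bar>)"
  have K: "0 \<le> K" unfolding K_def by (intro sum_nonneg mult_nonneg_nonneg w) simp
  obtain N' where N': "\<And>n. n \<ge> N' \<Longrightarrow> W n \<ge> 2 * K / e + 1"
    using Wtop unfolding filterlim_at_top eventually_sequentially by blast
  show "\<exists>no. \<forall>n\<ge>no. norm ((\<Sum>k=1..<n. w k * x k) / (\<Sum>k=1..<n. w k) - l) < e"
  proof (intro exI allI impI)
    fix n assume n: "n \<ge> max (max N 1) N'"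
    have "2 * K / e \<ge> 0" using K e by simp
    then have Wpos: "0 < W n" using N'[of n] n by linarith
    have "2 * K / e < W n" using N'[of n] n by linarith
    then have KW: "K < e / 2 * W n" using e by (simp add: field_simps)
    have "\<bar>(\<Sum>k=1..<n. w k * x k) - l * W n\<bar> = \<bar>\<Sum>k=1..<n. w k * (x k - l)\<bar>"
      by (simp add: W_def right_diff_distrib sum_subtractf sum_distrib_left mult.commute)
    also have "\<dots> \<le> (\<Sum>k=1..<n. w k * \<bar>x k - l\<bar>)"
      by (rule order_trans[OF sum_abs]) (simp add: abs_mult w)
    also have "\<dots> \<le> (\<Sum>k=1..<n. (if k < N then w k * \<bar>x k - l\<bar> else 0) + e / 2 * w k)"
    proof (rule sum_mono)
      fix k
      show "w k * \<bar>x k - l\<bar> \<le> (if k < N then w k * \<bar>x k - l\<bar> else 0) + e / 2 * w k"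
        using N[of k] w[of k] e mult_left_mono[of "\<bar>x k - l\<bar>" "e / 2" "w k"]
        by (auto simp: mult.commute)
    qed
    also have "\<dots> = (\<Sum>k=1..<n. if k < N then w k * \<bar>x k - l\<bar> else 0) + e / 2 * W n"
      by (simp only: sum.distrib W_def sum_distrib_left)
    also have "(\<Sum>k=1..<n. if k < N then w k * \<bar>x k - l\<bar> else 0) = K"
      unfolding K_def using n by (intro sum.mono_neutral_cong_right) auto
    finally have "\<bar>(\<Sum>k=1..<n. w k * x k) - l * W n\<bar> < e * W n"
      using KW by simp
    then show "norm ((\<Sum>k=1..<n. w k * x k) / (\<Sum>k=1..<n. w k) - l) < e"
      using Wpos unfolding W_def[symmetric]
      by (simp add: divide_diff_eq_iff pos_divide_less_eq)
  qed
qed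

text \<open>The factor \<open>g\<^sub>n\<close> by which the linear recursion \<open>D\<^sub>i\<^sub>+\<^sub>1 = (1 + b/i) D\<^sub>i\<close> expands from time \<open>1\<close> to
  time \<open>n\<close>.\<close>
definition growth :: "real \<Rightarrow> nat \<Rightarrow> real" where
  "growth b n = (\<Prod>j=1..<n. 1 + b / real j)"

lemma growth_1 [simp]: "growth b (Suc 0) = 1"
  by (simp add: growth_def)

lemma growth_Suc: "n \<ge> 1 \<Longrightarrow> growth b (Suc n) = growth b n * (1 + b / real n)"
  by (simp add: growth_def prod.atLeastLessThan_Suc)

lemma growth_ge_1: "0 \<le> b \<Longrightarrow> 1 \<le> growth b n"
  unfolding growth_def by (intro prod_ge_1) simp

text \<open>The induction rests on \<open>(2n - 1)(1 + 1/(2n))\<^sup>2 \<le> 2n + 1\<close>. The bound is what forces the weights below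
  to have a divergent sum up to and including the critical value \<open>b = 1/2\<close>.\<close>
lemma growth_square_le:
  assumes "0 \<le> b" "b \<le> 1 / 2" "n \<ge> 1"
  shows "(growth b n)\<^sup>2 \<le> 2 * real n - 1"
  using assms(3)
proof (induction n rule: nat_induct_at_least)
  case base
  then show ?case by simp
next
  case (Suc n)
  have n: "real n \<ge> 1" using Suc by simp
  have "(1 + b / real n)\<^sup>2 \<le> (1 + 1 / (2 * real n))\<^sup>2"
    using assms n by (intro power_mono) (auto simp: field_simps)
  then have "(growth b (Suc n))\<^sup>2 \<le> (2 * real n - 1) * (1 + 1 / (2 * real n))\<^sup>2"
    using Suc n by (auto simp: growth_Suc power_mult_distrib intro!: mult_mono)
  also have "\<dots> \<le> 2 * real (Suc n) - 1"
    using n by (simp add: field_simps power2_eq_square)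
  finally show ?case .
qed

text \<open>The noise added at step \<open>k\<close> to \<open>D\<^sub>k\<^sub>+\<^sub>1\<close> is scaled down by \<open>g\<^sub>k\<^sub>+\<^sub>1\<close> in the martingale \<open>D\<^sub>n/g\<^sub>n\<close>; the
  weight is the resulting factor in the variance.\<close>
definition weight :: "real \<Rightarrow> nat \<Rightarrow> real" where
  "weight b k = 1 / (growth b (Suc k))\<^sup>2"

lemma weight_nonneg: "0 \<le> weight b k"
  by (simp add: weight_def)

lemma weight_sum_at_top:
  assumes "0 \<le> b" "b \<le> 1 / 2"
  shows "filterlim (\<lambda>n. \<Sum>k=1..<n. weight b k) at_top sequentially"
proof -
  have "ln (real n) / 3 \<le> (\<Sum>k=1..<n. weight b k)" if "n \<ge> 1" for n
    using that
  proof (induction n rule: nat_induct_at_least)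
    case base
    then show ?case by simp
  next
    case (Suc n)
    have n: "real n \<ge> 1" using Suc by simp
    have "ln (real (Suc n)) = ln (real n) + ln (1 + 1 / real n)"
    proof -
      have "real (Suc n) = real n * (1 + 1 / real n)" using n by (simp add: field_simps)
      moreover have "0 < 1 + 1 / real n" using n by (auto intro: add_pos_nonneg)
      ultimately show ?thesis using n by (simp add: ln_mult)
    qed
    also have "\<dots> \<le> ln (real n) + 1 / real n"
      using n ln_add_one_self_le_self[of "1 / real n"] by simp
    finally have l: "ln (real (Suc n)) / 3 \<le> ln (real n) / 3 + 1 / (3 * real n)"
      by simp
    have "(growth b (Suc n))\<^sup>2 \<le> 3 * real n"
      using growth_square_le[OF assms, of "Suc n"] n by simp
    moreover have "0 < (growth b (Suc n))\<^sup>2"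
      using growth_ge_1[OF assms(1), of "Suc n"] by simp
    ultimately have "1 / (3 * real n) \<le> weight b n"
      unfolding weight_def using n by (intro divide_left_mono mult_pos_pos) auto
    then show ?case using l Suc by simp
  qed
  moreover have "filterlim (\<lambda>n. ln (real n) / 3) at_top sequentially" by real_asymp
  ultimately show ?thesis
    by (elim filterlim_at_top_mono) (auto simp: eventually_sequentially)
qed

text \<open>Telescoping: the \<open>k\<close>-th term of the sum is the increment of \<open>C\<^sub>k/g\<^sub>k\<^sup>2\<close>. If the bracket converges,
  \<open>weighted_Cesaro\<close> gives the ratio of this quotient to the accumulated weight.\<close>
lemma scale_eq_weighted_sum:
  fixes C :: "nat \<Rightarrow> real"
  assumes "0 \<le> b" "n \<ge> 1"
  shows "C n / (growth b n)\<^sup>2 =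
    C 1 + (\<Sum>k=1..<n. weight b k * (C (Suc k) - C k * (1 + b / real k)\<^sup>2))"
  using assms(2)
proof (induction n rule: nat_induct_at_least)
  case base
  then show ?case by simp
next
  case (Suc n)
  have nz: "1 + b / real n \<noteq> 0" "growth b n \<noteq> 0"
    using assms(1) growth_ge_1[OF assms(1), of n] add_pos_nonneg[of 1 "b / real n"] by auto
  have alg: "c' / (g * m)\<^sup>2 = c / g\<^sup>2 + 1 / (g * m)\<^sup>2 * (c' - c * m\<^sup>2)"
    if "m \<noteq> 0" "g \<noteq> 0" for c c' g m :: real
    using that by (simp add: field_simps power_mult_distrib)
  have "C (Suc n) / (growth b (Suc n))\<^sup>2 =
    C n / (growth b n)\<^sup>2 + weight b n * (C (Suc n) - C n * (1 + b / real n)\<^sup>2)"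
    using alg[OF nz, of "C (Suc n)" "C n"] Suc.hyps by (simp only: growth_Suc weight_def)
  then show ?case using Suc by simp
qed

section \<open>A single centred Bernoulli step\<close>

text \<open>The variance of the step is \<open>p (1 - p)\<close>, but the Gaussian factor uses the fixed value \<open>\<mu> (1 - \<mu>)\<close>,
  so that it can later be pulled out of the expectation over \<open>p\<close>. Both sides agree to second order
  up to the difference of these variances, which is at most \<open>\<bar>p - \<mu>\<bar>\<close>; the cubic term is the Taylor
  remainder of the characteristic function, the quartic one that of the Gaussian factor.\<close>
lemma centred_Bernoulli_char_approx:
  fixes p \<mu> u :: real
  assumes p: "0 \<le> p" "p \<le> 1" and mu: "0 \<le> \<mu>" "\<mu> \<le> 1"
  shows "cmod (p *\<^sub>R iexp (u * (1 - p)) + (1 - p) *\<^sub>R iexp (- (u * p)) - exp (- (u\<^sup>2 * (\<mu> * (1 - \<mu>)) / 2)))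
    \<le> u\<^sup>2 / 2 * \<bar>p - \<mu>\<bar> + \<bar>u\<bar> ^ 3 + u ^ 4"
proof -
  define R where "R x = iexp x - (1 + \<i> * x - x\<^sup>2 / 2)" for x :: real
  have R: "cmod (R x) \<le> \<bar>x\<bar> ^ 3 / 6" for x
    using iexp_approx1[of x 2]
    by (simp add: R_def eval_nat_numeral fact_numeral algebra_simps)
  define v where "v = \<mu> * (1 - \<mu>)"
  have v: "0 \<le> v" "v \<le> 1"
    using mu mult_mono[of \<mu> 1 "1 - \<mu>" 1] by (auto simp: v_def)
  define y where "y = u\<^sup>2 * v / 2"
  have y: "0 \<le> y" "y \<le> u\<^sup>2 / 2"
    using v by (auto simp: y_def mult_left_le)
  \<comment> \<open>The upper bound inverts \<open>exp y \<ge> 1 + y + y\<^sup>2/2\<close>, since \<open>(1 + y + y\<^sup>2/2)(1 - y + y\<^sup>2/2) = 1 + y\<^sup>4/4\<close>.\<close>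
  have E: "\<bar>exp (- y) - (1 - y)\<bar> \<le> y\<^sup>2 / 2"
  proof -
    have "1 - y \<le> exp (- y)" using exp_ge_add_one_self[of "- y"] by simp
    moreover have "exp (- y) \<le> 1 - y + y\<^sup>2 / 2"
    proof -
      have "(1 + y + y\<^sup>2 / 2) * (1 - y + y\<^sup>2 / 2) = 1 + y ^ 4 / 4"
        by (simp add: field_simps power2_eq_square power4_eq_xxxx)
      then have ge1: "1 \<le> (1 + y + y\<^sup>2 / 2) * (1 - y + y\<^sup>2 / 2)" by simp
      have "0 \<le> (1 - y)\<^sup>2 + 1" by simp
      then have nn: "0 \<le> 1 - y + y\<^sup>2 / 2" by (simp add: power2_eq_square field_simps)
      have "1 + y + y\<^sup>2 / 2 \<le> exp y"
        using exp_lower_Taylor_quadratic[OF y(1)] by simp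
      then have "1 \<le> exp y * (1 - y + y\<^sup>2 / 2)"
        using ge1 nn by (meson mult_right_mono order_trans)
      then show ?thesis by (simp add: exp_minus field_simps)
    qed
    ultimately show ?thesis by simp
  qed
  have y4: "y\<^sup>2 / 2 \<le> u ^ 4"
  proof -
    have "y\<^sup>2 \<le> (u\<^sup>2 / 2)\<^sup>2" using y by (intro power_mono)
    also have "\<dots> = u ^ 4 / 4" by (simp add: power2_eq_square power4_eq_xxxx)
    finally have "y\<^sup>2 \<le> u ^ 4 / 4" .
    moreover have "0 \<le> u ^ 4" by simp
    ultimately show ?thesis by linarith
  qed
  have "\<bar>p * (1 - p) - v\<bar> = \<bar>p - \<mu>\<bar> * \<bar>1 - p - \<mu>\<bar>"
    unfolding abs_mult[symmetric] by (simp add: v_def algebra_simps)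
  also have "\<dots> \<le> \<bar>p - \<mu>\<bar>"
    using p mu by (intro mult_left_le) auto
  finally have pv: "\<bar>p * (1 - p) - v\<bar> \<le> \<bar>p - \<mu>\<bar>" .
  have eq: "p *\<^sub>R iexp (u * (1 - p)) + (1 - p) *\<^sub>R iexp (- (u * p)) - exp (- y)
     = (p *\<^sub>R R (u * (1 - p)) + (1 - p) *\<^sub>R R (- (u * p)))
       + of_real (- (u\<^sup>2 / 2 * (p * (1 - p) - v))) - of_real (exp (- y) - (1 - y))"
    by (simp add: R_def y_def scaleR_conv_of_real field_simps power2_eq_square)
  have R': "cmod (R (u * q)) \<le> \<bar>u\<bar> ^ 3 / 6" if "\<bar>q\<bar> \<le> 1" for q
  proof -
    have "\<bar>u * q\<bar> ^ 3 \<le> \<bar>u\<bar> ^ 3"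
      using that by (intro power_mono) (auto simp: abs_mult mult_left_le)
    then show ?thesis using R[of "u * q"] by linarith
  qed
  have "cmod (p *\<^sub>R R (u * (1 - p))) \<le> p * (\<bar>u\<bar> ^ 3 / 6)"
      "cmod ((1 - p) *\<^sub>R R (- (u * p))) \<le> (1 - p) * (\<bar>u\<bar> ^ 3 / 6)"
    using p mult_left_mono[OF R'[of "1 - p"], of p] mult_left_mono[OF R'[of "- p"], of "1 - p"]
    by simp_all
  then have "cmod (p *\<^sub>R R (u * (1 - p)) + (1 - p) *\<^sub>R R (- (u * p)))
      \<le> p * (\<bar>u\<bar> ^ 3 / 6) + (1 - p) * (\<bar>u\<bar> ^ 3 / 6)"
    by (intro order_trans[OF norm_triangle_ineq] add_mono)
  also have "\<dots> \<le> \<bar>u\<bar> ^ 3" by (simp add: field_simps)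
  finally have A: "cmod (p *\<^sub>R R (u * (1 - p)) + (1 - p) *\<^sub>R R (- (u * p))) \<le> \<bar>u\<bar> ^ 3" .
  have B: "cmod (of_real (- (u\<^sup>2 / 2 * (p * (1 - p) - v)))) \<le> u\<^sup>2 / 2 * \<bar>p - \<mu>\<bar>"
    unfolding norm_of_real using pv by (simp add: abs_mult mult_left_mono)
  have D: "cmod (of_real (exp (- y) - (1 - y))) \<le> u ^ 4"
    unfolding norm_of_real using E y4 by linarith
  show ?thesis
    using norm_triangle_ineq4[of "(p *\<^sub>R R (u * (1 - p)) + (1 - p) *\<^sub>R R (- (u * p)))
       + of_real (- (u\<^sup>2 / 2 * (p * (1 - p) - v)))" "of_real (exp (- y) - (1 - y))"]
      norm_triangle_ineq[of "p *\<^sub>R R (u * (1 - p)) + (1 - p) *\<^sub>R R (- (u * p))" "of_real (- (u\<^sup>2 / 2 * (p * (1 - p) - v)))"]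
      A B D
    unfolding v_def[symmetric] y_def[symmetric] eq by linarith
qed

section \<open>Bernoulli sequences with linear reinforcement\<close>

lemma measurable_nat_pair:
  fixes f g :: "'a \<Rightarrow> nat"
  assumes "f \<in> M \<rightarrow>\<^sub>M count_space UNIV" "g \<in> M \<rightarrow>\<^sub>M count_space UNIV" "\<And>s x. h s x \<in> space N"
  shows "(\<lambda>\<omega>. h (f \<omega>) (g \<omega>)) \<in> M \<rightarrow>\<^sub>M N"
proof -
  have "(\<lambda>\<omega>. case (f \<omega>, g \<omega>) of (s, x) \<Rightarrow> h s x) \<in> M \<rightarrow>\<^sub>M N"
    by (rule measurable_compose[where N="count_space UNIV \<Otimes>\<^sub>M count_space UNIV"])
       (use assms in \<open>auto simp: pair_measure_countable\<close>)
  then show ?thesis by simp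
qed

text \<open>The assumption on a step is the product form of \<open>P(X\<^sub>i\<^sub>+\<^sub>1 = 1 | S\<^sub>i = s) = a + b s/i\<close>, so it also makes
  sense for values \<open>s\<close> of probability zero.\<close>
locale reinforced_Bernoulli = prob_space M
  for M :: "'a measure" and X :: "nat \<Rightarrow> 'a \<Rightarrow> nat" and a b :: real +
  assumes X_measurable: "\<And>i. i \<ge> 1 \<Longrightarrow> X i \<in> M \<rightarrow>\<^sub>M count_space UNIV"
    and X_range: "\<And>i \<omega>. i \<ge> 1 \<Longrightarrow> \<omega> \<in> space M \<Longrightarrow> X i \<omega> \<in> {0, 1}"
    and a_nonneg: "0 \<le> a" and b_nonneg: "0 \<le> b" and b_le_half: "b \<le> 1 / 2" and ab_le_1: "a + b \<le> 1"
    and step: "\<And>i s. i \<ge> 1 \<Longrightarrow> s \<le> i \<Longrightarrow>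
      \<P>(\<omega> in M. partial_sum X i \<omega> = s \<and> X (Suc i) \<omega> = 1) =
      (a + b * real s / real i) * \<P>(\<omega> in M. partial_sum X i \<omega> = s)"
begin

abbreviation "S \<equiv> partial_sum X"

text \<open>The fixed point of \<open>x \<mapsto> a + b x\<close>, and hence the limit of \<open>S\<^sub>n/n\<close>.\<close>
definition \<mu> :: real where "\<mu> = a / (1 - b)"

definition p :: "nat \<Rightarrow> nat \<Rightarrow> real" where "p i s = a + b * real s / real i"

definition dev :: "nat \<Rightarrow> nat \<Rightarrow> real" where "dev i s = real s - real i * \<mu>"

lemma \<mu>_range: "0 \<le> \<mu>" "\<mu> \<le> 1"
  using a_nonneg b_le_half ab_le_1 by (auto simp: \<mu>_def divide_le_eq)

lemma p_range: "i \<ge> 1 \<Longrightarrow> s \<le> i \<Longrightarrow> 0 \<le> p i s \<and> p i s \<le> 1"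
proof -
  assume i: "i \<ge> 1" "s \<le> i"
  then have "b * (real s / real i) \<le> b * 1"
    using b_nonneg by (intro mult_left_mono) auto
  then show ?thesis
    using a_nonneg b_nonneg ab_le_1 by (simp add: p_def)
qed

text \<open>The choice of \<open>\<mu>\<close> makes the drift of the deviation linear without a constant term.\<close>
lemma p_eq: "i \<ge> 1 \<Longrightarrow> p i s = \<mu> + b / real i * dev i s"
proof -
  assume "i \<ge> 1"
  moreover have "a = \<mu> * (1 - b)" using b_le_half by (simp add: \<mu>_def)
  ultimately show ?thesis by (simp add: p_def dev_def algebra_simps)
qed

lemma S_measurable [measurable]: "S i \<in> M \<rightarrow>\<^sub>M count_space UNIV"
proof (induction i)
  case 0
  then show ?case by (simp add: partial_sum_def[abs_def])
next
  case (Suc i)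
  then have "(\<lambda>\<omega>. S i \<omega> + X (Suc i) \<omega>) \<in> M \<rightarrow>\<^sub>M count_space UNIV"
    using X_measurable[of "Suc i"] measurable_nat_pair[of "S i" M "X (Suc i)" "(+)" "count_space UNIV"] by simp
  then show ?case by (simp add: partial_sum_def[abs_def])
qed

lemma X_Suc_measurable [measurable]: "X (Suc i) \<in> M \<rightarrow>\<^sub>M count_space UNIV"
  by (rule X_measurable) simp

lemma S_Suc: "S (Suc i) \<omega> = S i \<omega> + X (Suc i) \<omega>"
  by (simp add: partial_sum_def)

lemma S_le: "\<omega> \<in> space M \<Longrightarrow> S i \<omega> \<le> i"
proof (induction i)
  case 0
  then show ?case by (simp add: partial_sum_def)
next
  case (Suc i)
  then show ?case using X_range[of "Suc i" \<omega>] by (auto simp: S_Suc)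
qed

lemma integrable_walk:
  fixes f :: "nat \<Rightarrow> nat \<Rightarrow> 'b :: {banach, second_countable_topology}"
  shows "integrable M (\<lambda>\<omega>. f (S i \<omega>) (X (Suc i) \<omega>))"
proof (rule integrable_const_bound)
  show "AE \<omega> in M. norm (f (S i \<omega>) (X (Suc i) \<omega>)) \<le> (\<Sum>s\<le>i. \<Sum>x\<le>1. norm (f s x))"
  proof (rule AE_I2)
    fix \<omega> assume \<omega>: "\<omega> \<in> space M"
    have s: "S i \<omega> \<in> {..i}" and x: "X (Suc i) \<omega> \<in> {..1}"
      using S_le[OF \<omega>] X_range[of "Suc i" \<omega>] \<omega> by auto
    have "norm (f (S i \<omega>) (X (Suc i) \<omega>)) \<le> (\<Sum>x\<le>1. norm (f (S i \<omega>) x))"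
      using x by (intro member_le_sum[where f="\<lambda>x. norm (f (S i \<omega>) x)"]) auto
    also have "\<dots> \<le> (\<Sum>s\<le>i. \<Sum>x\<le>1. norm (f s x))"
      using s by (intro member_le_sum[where f="\<lambda>s. \<Sum>x\<le>1. norm (f s x)"]) (auto intro: sum_nonneg)
    finally show "norm (f (S i \<omega>) (X (Suc i) \<omega>)) \<le> (\<Sum>s\<le>i. \<Sum>x\<le>1. norm (f s x))" .
  qed
  show "(\<lambda>\<omega>. f (S i \<omega>) (X (Suc i) \<omega>)) \<in> borel_measurable M"
    by (rule measurable_nat_pair[where h=f, OF S_measurable X_Suc_measurable]) simp
qed

lemma integrable_S:
  fixes f :: "nat \<Rightarrow> 'b :: {banach, second_countable_topology}"
  shows "integrable M (\<lambda>\<omega>. f (S i \<omega>))"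
  using integrable_walk[of "\<lambda>s x. f s" i] by simp

text \<open>The only place where the step probabilities enter: the pair of \<open>S\<^sub>i\<close> and \<open>X\<^sub>i\<^sub>+\<^sub>1\<close> can be replaced by
  \<open>S\<^sub>i\<close> and a Bernoulli choice given \<open>S\<^sub>i\<close>. It is stated for Banach space valued functions to serve both
  real second moments and complex characteristic functions.\<close>
lemma expectation_step:
  fixes f :: "nat \<Rightarrow> nat \<Rightarrow> 'b :: {banach, second_countable_topology}"
  assumes i: "i \<ge> 1"
  shows "(\<integral>\<omega>. f (S i \<omega>) (X (Suc i) \<omega>) \<partial>M) =
    (\<integral>\<omega>. p i (S i \<omega>) *\<^sub>R f (S i \<omega>) 1 + (1 - p i (S i \<omega>)) *\<^sub>R f (S i \<omega>) 0 \<partial>M)"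
proof -
  \<comment> \<open>An affine function of \<open>X\<^sub>i\<^sub>+\<^sub>1\<close> suffices, as \<open>X\<^sub>i\<^sub>+\<^sub>1\<close> has only two values.\<close>
  have key: "(\<integral>\<omega>. real (X (Suc i) \<omega>) *\<^sub>R h (S i \<omega>) \<partial>M) = (\<integral>\<omega>. p i (S i \<omega>) *\<^sub>R h (S i \<omega>) \<partial>M)"
    for h :: "nat \<Rightarrow> 'b"
  proof -
    define A where "A s = {\<omega> \<in> space M. S i \<omega> = s}" for s
    define B where "B s = {\<omega> \<in> space M. S i \<omega> = s \<and> X (Suc i) \<omega> = 1}" for s
    have [measurable]: "A s \<in> events" "B s \<in> events" for s
      unfolding A_def B_def by measurable
    have "(\<integral>\<omega>. real (X (Suc i) \<omega>) *\<^sub>R h (S i \<omega>) \<partial>M) =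
        (\<integral>\<omega>. (\<Sum>s\<le>i. indicat_real (B s) \<omega> *\<^sub>R h s) \<partial>M)"
    proof (rule Bochner_Integration.integral_cong[OF refl])
      fix \<omega> assume \<omega>: "\<omega> \<in> space M"
      have "(\<Sum>s\<le>i. indicat_real (B s) \<omega> *\<^sub>R h s) =
          (\<Sum>s\<in>{..i}. if s = S i \<omega> then real (X (Suc i) \<omega>) *\<^sub>R h s else 0)"
        using \<omega> X_range[of "Suc i" \<omega>] by (intro sum.cong) (auto simp: B_def indicator_def)
      then show "real (X (Suc i) \<omega>) *\<^sub>R h (S i \<omega>) = (\<Sum>s\<le>i. indicat_real (B s) \<omega> *\<^sub>R h s)"
        using S_le[OF \<omega>, of i] by simp
    qed
    also have "\<dots> = (\<Sum>s\<le>i. prob (B s) *\<^sub>R h s)"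
      by (subst Bochner_Integration.integral_sum)
         (auto intro!: integrable_scaleR_left simp: integrable_indicator_iff emeasure_eq_measure)
    also have "\<dots> = (\<Sum>s\<le>i. (p i s * prob (A s)) *\<^sub>R h s)"
      using step[OF i] by (simp add: A_def B_def p_def)
    also have "\<dots> = (\<integral>\<omega>. (\<Sum>s\<le>i. indicat_real (A s) \<omega> *\<^sub>R (p i s *\<^sub>R h s)) \<partial>M)"
      by (subst Bochner_Integration.integral_sum)
         (auto intro!: integrable_scaleR_left simp: integrable_indicator_iff emeasure_eq_measure mult.commute)
    also have "\<dots> = (\<integral>\<omega>. p i (S i \<omega>) *\<^sub>R h (S i \<omega>) \<partial>M)"
    proof (rule Bochner_Integration.integral_cong[OF refl])
      fix \<omega> assume \<omega>: "\<omega> \<in> space M"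
      have "(\<Sum>s\<le>i. indicat_real (A s) \<omega> *\<^sub>R (p i s *\<^sub>R h s)) =
          (\<Sum>s\<in>{..i}. if s = S i \<omega> then p i s *\<^sub>R h s else 0)"
        using \<omega> by (intro sum.cong) (auto simp: A_def indicator_def)
      then show "(\<Sum>s\<le>i. indicat_real (A s) \<omega> *\<^sub>R (p i s *\<^sub>R h s)) = p i (S i \<omega>) *\<^sub>R h (S i \<omega>)"
        using S_le[OF \<omega>, of i] by simp
    qed
    finally show ?thesis .
  qed
  have "(\<integral>\<omega>. f (S i \<omega>) (X (Suc i) \<omega>) \<partial>M) =
     (\<integral>\<omega>. f (S i \<omega>) 0 + real (X (Suc i) \<omega>) *\<^sub>R (f (S i \<omega>) 1 - f (S i \<omega>) 0) \<partial>M)"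
    using X_range[of "Suc i"] by (intro Bochner_Integration.integral_cong) fastforce+
  also have "\<dots> = (\<integral>\<omega>. f (S i \<omega>) 0 \<partial>M) + (\<integral>\<omega>. real (X (Suc i) \<omega>) *\<^sub>R (f (S i \<omega>) 1 - f (S i \<omega>) 0) \<partial>M)"
    using integrable_walk[of "\<lambda>s x. f s 0" i] integrable_walk[of "\<lambda>s x. real x *\<^sub>R (f s 1 - f s 0)" i]
    by (rule Bochner_Integration.integral_add)
  also have "\<dots> = (\<integral>\<omega>. f (S i \<omega>) 0 \<partial>M) + (\<integral>\<omega>. p i (S i \<omega>) *\<^sub>R (f (S i \<omega>) 1 - f (S i \<omega>) 0) \<partial>M)"
    using key[of "\<lambda>s. f s 1 - f s 0"] by simp
  also have "\<dots> = (\<integral>\<omega>. f (S i \<omega>) 0 + p i (S i \<omega>) *\<^sub>R (f (S i \<omega>) 1 - f (S i \<omega>) 0) \<partial>M)"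
    using integrable_S[of "\<lambda>s. f s 0" i] integrable_S[of "\<lambda>s. p i s *\<^sub>R (f s 1 - f s 0)" i]
    by (rule Bochner_Integration.integral_add[symmetric])
  finally show ?thesis by (simp add: algebra_simps)
qed

text \<open>The second moment grows by the factor \<open>(1 + b/i)\<^sup>2 \<le> (1 + 1/(2i))\<^sup>2\<close> plus at most \<open>1/4\<close> in each step, so
  its true order is at most \<open>i log i\<close>. Any bound of lower order than \<open>i\<^sup>2\<close> serves; the power \<open>3/2\<close> is
  convenient, since it exceeds the critical growth exponent and absorbs the added constant.\<close>
lemma second_moment_bound:
  assumes "i \<ge> 1"
  shows "(\<integral>\<omega>. (dev i (S i \<omega>))\<^sup>2 \<partial>M) \<le> real i * sqrt (real i)"
  using assms
proof (induction i rule: nat_induct_at_least)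
  case base
  have "(\<integral>\<omega>. (dev 1 (S 1 \<omega>))\<^sup>2 \<partial>M) \<le> (\<integral>\<omega>. 1 \<partial>M)"
  proof (rule integral_mono)
    show "integrable M (\<lambda>\<omega>. (dev 1 (S 1 \<omega>))\<^sup>2)" by (rule integrable_S)
    fix \<omega> assume \<omega>: "\<omega> \<in> space M"
    have "\<bar>dev 1 (S 1 \<omega>)\<bar> \<le> 1"
      using X_range[of 1 \<omega>] \<omega> \<mu>_range by (auto simp: dev_def partial_sum_def)
    then show "(dev 1 (S 1 \<omega>))\<^sup>2 \<le> 1" by (simp add: abs_square_le_1)
  qed simp
  then show ?case by (simp add: prob_space)
next
  case (Suc i)
  define n where "n = real i"
  have n: "n \<ge> 1" using Suc by (simp add: n_def)
  have sn: "sqrt n \<ge> 1" using n by simp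
  have "(\<integral>\<omega>. (dev (Suc i) (S (Suc i) \<omega>))\<^sup>2 \<partial>M) =
      (\<integral>\<omega>. p i (S i \<omega>) *\<^sub>R (dev (Suc i) (S i \<omega> + 1))\<^sup>2 + (1 - p i (S i \<omega>)) *\<^sub>R (dev (Suc i) (S i \<omega> + 0))\<^sup>2 \<partial>M)"
    using expectation_step[OF Suc.hyps, of "\<lambda>s x. (dev (Suc i) (s + x))\<^sup>2"] by (simp add: S_Suc)
  also have "\<dots> \<le> (\<integral>\<omega>. (1 + b / n)\<^sup>2 * (dev i (S i \<omega>))\<^sup>2 + 1 / 4 \<partial>M)"
  proof (rule integral_mono)
    fix \<omega> assume "\<omega> \<in> space M"
    define d where "d = dev i (S i \<omega>)"
    define c where "c = b / n"
    define q where "q = p i (S i \<omega>)"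
    have q: "q = \<mu> + c * d" using p_eq[OF Suc.hyps] by (simp add: q_def c_def d_def n_def)
    have d1: "dev (Suc i) (S i \<omega> + 1) = d + 1 - \<mu>" and d0: "dev (Suc i) (S i \<omega> + 0) = d - \<mu>"
      by (simp_all add: d_def dev_def algebra_simps)
    have "q * (d + 1 - \<mu>)\<^sup>2 + (1 - q) * (d - \<mu>)\<^sup>2 = (1 + c)\<^sup>2 * d\<^sup>2 + q * (1 - q)"
      unfolding q by algebra
    also have "q * (1 - q) \<le> 1 / 4"
      using zero_le_power2[of "q - 1 / 2"] by (simp add: power2_eq_square field_simps)
    finally show "p i (S i \<omega>) *\<^sub>R (dev (Suc i) (S i \<omega> + 1))\<^sup>2 + (1 - p i (S i \<omega>)) *\<^sub>R (dev (Suc i) (S i \<omega> + 0))\<^sup>2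
        \<le> (1 + b / n)\<^sup>2 * (dev i (S i \<omega>))\<^sup>2 + 1 / 4"
      by (simp only: q_def[symmetric] d1 d0 c_def[symmetric] d_def[symmetric] real_scaleR_def)
  qed (rule integrable_S)+
  also have "\<dots> = (1 + b / n)\<^sup>2 * (\<integral>\<omega>. (dev i (S i \<omega>))\<^sup>2 \<partial>M) + 1 / 4"
    using integrable_S[of "\<lambda>s. (dev i s)\<^sup>2" i] by (simp add: prob_space)
  also have "\<dots> \<le> (1 + 1 / (2 * n))\<^sup>2 * (n * sqrt n) + 1 / 4"
    using Suc.IH n b_nonneg b_le_half
    by (intro add_right_mono mult_mono power_mono) (auto simp: n_def field_simps)
  also have "\<dots> \<le> (1 + 3 / (2 * n)) * (n * sqrt n)"
  proof -
    have "(1 + 3 / (2 * n)) * (n * sqrt n) - ((1 + 1 / (2 * n))\<^sup>2 * (n * sqrt n) + 1 / 4)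
       = sqrt n / 2 - sqrt n / (4 * n) - 1 / 4"
      using n by (simp add: power2_eq_square field_simps)
    moreover have "sqrt n / (4 * n) \<le> sqrt n / 4"
      using n sn by (simp add: field_simps)
    ultimately show ?thesis using sn by linarith
  qed
  \<comment> \<open>After squaring, this is \<open>n (n + 3/2)\<^sup>2 \<le> (n + 1)\<^sup>3\<close>.\<close>
  also have "\<dots> \<le> (n + 1) * sqrt (n + 1)"
  proof -
    have "((1 + 3 / (2 * n)) * (n * sqrt n))\<^sup>2 \<le> ((n + 1) * sqrt (n + 1))\<^sup>2"
      using n by (simp add: power_mult_distrib) (simp add: power2_eq_square field_simps)
    then show ?thesis by (rule power2_le_imp_le) (use n in simp)
  qed
  finally show ?case by (simp add: n_def add.commute)
qed

lemma abs_moment_bound: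
  assumes "i \<ge> 1"
  shows "(\<integral>\<omega>. \<bar>dev i (S i \<omega>)\<bar> \<partial>M) \<le> sqrt (real i * sqrt (real i))"
proof (rule real_le_rsqrt)
  have "0 \<le> variance (\<lambda>\<omega>. \<bar>dev i (S i \<omega>)\<bar>)" by (rule variance_positive)
  also have "\<dots> = (\<integral>\<omega>. \<bar>dev i (S i \<omega>)\<bar>\<^sup>2 \<partial>M) - (\<integral>\<omega>. \<bar>dev i (S i \<omega>)\<bar> \<partial>M)\<^sup>2"
    by (intro variance_eq integrable_S)
  finally show "(\<integral>\<omega>. \<bar>dev i (S i \<omega>)\<bar> \<partial>M)\<^sup>2 \<le> real i * sqrt (real i)"
    using second_moment_bound[OF assms] by simp
qed

subsection \<open>Evolution of the characteristic function\<close>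

definition \<psi> :: "nat \<Rightarrow> real \<Rightarrow> complex" where
  "\<psi> i u = (\<integral>\<omega>. iexp (u * dev i (S i \<omega>)) \<partial>M)"

text \<open>A bound for \<open>E \<bar>p - \<mu>\<bar>\<close>, the mean deviation of the step probability at time \<open>i\<close> from its limit.\<close>
definition drift_error :: "nat \<Rightarrow> real" where
  "drift_error i = b * (sqrt (real i * sqrt (real i)) / real i)"

text \<open>Given \<open>S\<^sub>i\<close>, the characteristic function of the centred step \<open>X\<^sub>i\<^sub>+\<^sub>1 - p\<close> is nearly a constant Gaussian
  factor, while \<open>D\<^sub>i\<^sub>+\<^sub>1\<close> is \<open>(1 + b/i) D\<^sub>i\<close> plus that step.\<close>
lemma \<psi>_step:
  assumes i: "i \<ge> 1"
  shows "cmod (\<psi> (Suc i) u - exp (- (u\<^sup>2 * (\<mu> * (1 - \<mu>)) / 2)) * \<psi> i (u * (1 + b / real i)))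
    \<le> u\<^sup>2 / 2 * drift_error i + \<bar>u\<bar> ^ 3 + u ^ 4"
proof -
  define G where "G s = p i s *\<^sub>R iexp (u * (1 - p i s)) + (1 - p i s) *\<^sub>R iexp (- (u * p i s))" for s
  define E where "E = complex_of_real (exp (- (u\<^sup>2 * (\<mu> * (1 - \<mu>)) / 2)))"
  define F where "F s = iexp (u * (1 + b / real i) * dev i s)" for s
  have dev1: "dev (Suc i) (s + 1) = (1 + b / real i) * dev i s + (1 - p i s)"
    and dev0: "dev (Suc i) s = (1 + b / real i) * dev i s - p i s" for s
    unfolding p_eq[OF i] by (simp_all add: dev_def algebra_simps)
  have F1: "iexp (u * dev (Suc i) (s + 1)) = F s * iexp (u * (1 - p i s))" for s
    unfolding dev1 F_def exp_add[symmetric] by (simp add: algebra_simps)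
  have F0: "iexp (u * dev (Suc i) (s + 0)) = F s * iexp (- (u * p i s))" for s
    unfolding dev0 F_def exp_add[symmetric] add_0_right by (simp add: algebra_simps)
  have "\<psi> (Suc i) u = (\<integral>\<omega>. p i (S i \<omega>) *\<^sub>R iexp (u * dev (Suc i) (S i \<omega> + 1))
      + (1 - p i (S i \<omega>)) *\<^sub>R iexp (u * dev (Suc i) (S i \<omega> + 0)) \<partial>M)"
    using expectation_step[OF i, of "\<lambda>s x. iexp (u * dev (Suc i) (s + x))"] by (simp add: S_Suc \<psi>_def)
  also have "\<dots> = (\<integral>\<omega>. F (S i \<omega>) * G (S i \<omega>) \<partial>M)"
    unfolding F1 F0 G_def by (simp add: distrib_left)
  finally have "\<psi> (Suc i) u - E * \<psi> i (u * (1 + b / real i)) = (\<integral>\<omega>. F (S i \<omega>) * G (S i \<omega>) - E * F (S i \<omega>) \<partial>M)"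
    using integrable_S[of "\<lambda>s. F s * G s" i] integrable_S[of "\<lambda>s. E * F s" i] integrable_S[of F i]
    by (simp add: \<psi>_def F_def)
  also have "cmod \<dots> \<le> (\<integral>\<omega>. cmod (F (S i \<omega>) * G (S i \<omega>) - E * F (S i \<omega>)) \<partial>M)"
    by (rule integral_norm_bound)
  also have "\<dots> \<le> (\<integral>\<omega>. u\<^sup>2 / 2 * (b / real i * \<bar>dev i (S i \<omega>)\<bar>) + (\<bar>u\<bar> ^ 3 + u ^ 4) \<partial>M)"
  proof (rule integral_mono)
    fix \<omega> assume \<omega>: "\<omega> \<in> space M"
    have "F (S i \<omega>) * G (S i \<omega>) - E * F (S i \<omega>) = F (S i \<omega>) * (G (S i \<omega>) - E)"
      by (simp add: algebra_simps)
    then have "cmod (F (S i \<omega>) * G (S i \<omega>) - E * F (S i \<omega>)) = cmod (G (S i \<omega>) - E)"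
      by (simp add: norm_mult F_def)
    also have "\<dots> \<le> u\<^sup>2 / 2 * \<bar>p i (S i \<omega>) - \<mu>\<bar> + \<bar>u\<bar> ^ 3 + u ^ 4"
      using centred_Bernoulli_char_approx[of "p i (S i \<omega>)" \<mu> u] p_range[OF i S_le[OF \<omega>]] \<mu>_range
      by (simp add: G_def E_def)
    also have "\<bar>p i (S i \<omega>) - \<mu>\<bar> = b / real i * \<bar>dev i (S i \<omega>)\<bar>"
      using b_nonneg by (simp add: p_eq[OF i] abs_mult)
    finally show "cmod (F (S i \<omega>) * G (S i \<omega>) - E * F (S i \<omega>))
      \<le> u\<^sup>2 / 2 * (b / real i * \<bar>dev i (S i \<omega>)\<bar>) + (\<bar>u\<bar> ^ 3 + u ^ 4)" by simp
  qed (rule integrable_S)+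
  also have "\<dots> = u\<^sup>2 / 2 * (b / real i * (\<integral>\<omega>. \<bar>dev i (S i \<omega>)\<bar> \<partial>M)) + (\<bar>u\<bar> ^ 3 + u ^ 4)"
    using integrable_S[of "\<lambda>s. \<bar>dev i s\<bar>" i] by (simp add: prob_space)
  also have "\<dots> \<le> u\<^sup>2 / 2 * (b / real i * sqrt (real i * sqrt (real i))) + (\<bar>u\<bar> ^ 3 + u ^ 4)"
    using abs_moment_bound[OF i] b_nonneg by (intro add_right_mono mult_left_mono) auto
  finally show ?thesis by (simp add: E_def drift_error_def)
qed

text \<open>At argument \<open>\<theta>/g\<^sub>n\<close> the factors \<open>1 + b/i\<close> cancel against those of \<open>g\<close>, so the steps chain together
  with one common \<open>\<theta>\<close>. Each error is carried on by Gaussian factors of modulus at most \<open>1\<close>. The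
  cubic and quartic errors would have the smaller factors \<open>1/g\<^sup>3\<close> and \<open>1/g\<^sup>4\<close>; as \<open>g \<ge> 1\<close>, they are
  bounded with the weight \<open>1/g\<^sup>2\<close> common to all terms.\<close>
lemma \<psi>_telescope:
  assumes "n \<ge> 1"
  shows "cmod (\<psi> n (\<theta> / growth b n) - exp (- (\<theta>\<^sup>2 * (\<Sum>k=1..<n. weight b k) * (\<mu> * (1 - \<mu>)) / 2)) * \<psi> 1 \<theta>)
    \<le> (\<Sum>k=1..<n. weight b k * (\<theta>\<^sup>2 / 2 * drift_error k + (\<bar>\<theta>\<bar> ^ 3 + \<theta> ^ 4)))"
  using assms
proof (induction n rule: nat_induct_at_least)
  case base
  then show ?case by simp
next
  case (Suc n)
  define g where "g = growth b (Suc n)"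
  define v where "v = \<mu> * (1 - \<mu>)"
  define W where "W = (\<Sum>k=1..<n. weight b k)"
  define u where "u = \<theta> / g"
  have g: "g \<ge> 1" using growth_ge_1[OF b_nonneg] by (simp add: g_def)
  have gn: "growth b n \<ge> 1" using growth_ge_1[OF b_nonneg] by simp
  have m: "1 + b / real n > 0" using b_nonneg by (intro add_pos_nonneg) auto
  have w: "weight b n = 1 / g\<^sup>2" by (simp add: weight_def g_def)
  have v: "0 \<le> v" using \<mu>_range by (simp add: v_def)
  have u': "u * (1 + b / real n) = \<theta> / growth b n"
    using Suc.hyps m gn by (simp add: u_def g_def growth_Suc)
  have u2: "u\<^sup>2 = weight b n * \<theta>\<^sup>2" by (simp add: u_def w power_divide)
  have u3: "\<bar>u\<bar> ^ 3 \<le> weight b n * \<bar>\<theta>\<bar> ^ 3"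
    using g by (auto simp: u_def w power_divide intro!: divide_left_mono power_increasing)
  have u4: "u ^ 4 \<le> weight b n * \<theta> ^ 4"
    using g by (auto simp: u_def w power_divide intro!: divide_left_mono power_increasing)
  define e where "e = exp (- (u\<^sup>2 * v / 2))"
  have e: "0 \<le> e" "e \<le> 1" using v by (auto simp: e_def)
  have eW: "exp (- (\<theta>\<^sup>2 * (W + weight b n) * v / 2)) = e * exp (- (\<theta>\<^sup>2 * W * v / 2))"
    by (simp add: e_def exp_add[symmetric] u2 field_simps)
  have "\<psi> (Suc n) u - of_real (exp (- (\<theta>\<^sup>2 * (W + weight b n) * v / 2))) * \<psi> 1 \<theta> =
     (\<psi> (Suc n) u - of_real e * \<psi> n (\<theta> / growth b n)) +
     of_real e * (\<psi> n (\<theta> / growth b n) - of_real (exp (- (\<theta>\<^sup>2 * W * v / 2))) * \<psi> 1 \<theta>)"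
    unfolding eW by (simp add: algebra_simps)
  also have "cmod \<dots> \<le> (u\<^sup>2 / 2 * drift_error n + \<bar>u\<bar> ^ 3 + u ^ 4) +
     1 * cmod (\<psi> n (\<theta> / growth b n) - of_real (exp (- (\<theta>\<^sup>2 * W * v / 2))) * \<psi> 1 \<theta>)"
  proof (intro order_trans[OF norm_triangle_ineq] add_mono)
    show "cmod (\<psi> (Suc n) u - of_real e * \<psi> n (\<theta> / growth b n)) \<le> u\<^sup>2 / 2 * drift_error n + \<bar>u\<bar> ^ 3 + u ^ 4"
      using \<psi>_step[OF Suc.hyps, of u] by (simp add: u' v_def e_def)
    show "cmod (of_real e * z) \<le> 1 * cmod z" for z
      unfolding norm_mult using e by (intro mult_right_mono) auto
  qed
  also have "\<dots> \<le> weight b n * (\<theta>\<^sup>2 / 2 * drift_error n + (\<bar>\<theta>\<bar> ^ 3 + \<theta> ^ 4)) +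
     (\<Sum>k=1..<n. weight b k * (\<theta>\<^sup>2 / 2 * drift_error k + (\<bar>\<theta>\<bar> ^ 3 + \<theta> ^ 4)))"
    using Suc.IH u3 u4 by (intro add_mono) (auto simp: W_def v_def u2 algebra_simps)
  finally show ?case
    using Suc.hyps by (simp add: W_def v_def u_def g_def add.commute)
qed

lemma drift_error_tendsto_0: "drift_error \<longlonglongrightarrow> 0"
proof -
  have "(\<lambda>i. sqrt (real i * sqrt (real i)) / real i) \<longlonglongrightarrow> 0" by real_asymp
  from tendsto_mult[OF tendsto_const this, of b] show ?thesis
    unfolding drift_error_def[abs_def] by (simp only: mult_zero_right)
qed

lemma \<psi>_1_tendsto:
  assumes "\<theta> \<longlonglongrightarrow> 0"
  shows "(\<lambda>n. \<psi> 1 (\<theta> n)) \<longlonglongrightarrow> 1"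
proof -
  have "(\<lambda>n. \<integral>\<omega>. iexp (\<theta> n * dev 1 (S 1 \<omega>)) \<partial>M) \<longlonglongrightarrow> (\<integral>\<omega>. 1 \<partial>M)"
  proof (rule integral_dominated_convergence[where w="\<lambda>_. 1"])
    show "AE \<omega> in M. (\<lambda>n. iexp (\<theta> n * dev 1 (S 1 \<omega>))) \<longlonglongrightarrow> 1"
      by (intro AE_I2) (auto intro!: tendsto_eq_intros assms)
    show "(\<lambda>\<omega>. iexp (\<theta> n * dev 1 (S 1 \<omega>))) \<in> borel_measurable M" for n
      using integrable_S[of "\<lambda>s. iexp (\<theta> n * dev 1 s)" 1] by simp
  qed auto
  then show ?thesis by (simp add: \<psi>_def prob_space)
qed

subsection \<open>The central limit theorem\<close>

text \<open>The number \<open>L\<close> is the limit of \<open>C\<^sub>n/(g\<^sub>n\<^sup>2 W\<^sub>n)\<close>. At \<open>\<theta> = t g\<^sub>n/sqrt C\<^sub>n\<close> the Gaussian exponent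
  \<open>\<theta>\<^sup>2 W\<^sub>n\<close> therefore tends to \<open>t\<^sup>2/L\<close>; as \<open>W\<^sub>n\<close> diverges, \<open>\<theta>\<close> itself tends to \<open>0\<close>, which removes the
  cubic and quartic errors and the influence of \<open>S\<^sub>1\<close>. The drift error is \<open>\<theta>\<^sup>2 W\<^sub>n\<close> times a weighted mean
  of a null sequence.\<close>
theorem clt:
  fixes C :: "nat \<Rightarrow> real"
  assumes L: "0 < L"
    and C: "(\<lambda>k. C (Suc k) - C k * (1 + b / real k)\<^sup>2) \<longlonglongrightarrow> L"
  shows "weak_conv_m (\<lambda>n. distr M borel (\<lambda>\<omega>. dev n (S n \<omega>) / sqrt (C n))) (normal_law 0 (\<mu> * (1 - \<mu>) / L))"
proof (rule levy_continuity)
  define v where "v = \<mu> * (1 - \<mu>)"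
  have v: "0 \<le> v / L" using \<mu>_range L by (simp add: v_def)
  have meas [measurable]: "(\<lambda>\<omega>. dev n (S n \<omega>) / sqrt (C n)) \<in> borel_measurable M" for n
    using integrable_S[of "\<lambda>s. dev n s / sqrt (C n)" n] by (rule borel_measurable_integrable)
  show "real_distribution (distr M borel (\<lambda>\<omega>. dev n (S n \<omega>) / sqrt (C n)))" for n
    by (rule real_distribution_distr) (rule meas)
  show "real_distribution (normal_law 0 (\<mu> * (1 - \<mu>) / L))"
    using v by (intro real_distribution_normal_law) (simp add: v_def)
  fix t :: real
  define W where "W n = (\<Sum>k=1..<n. weight b k)" for n
  define q where "q n = C n / (growth b n)\<^sup>2" for n
  define \<theta> where "\<theta> n = t * growth b n / sqrt (C n)" for n
  have W: "filterlim W at_top sequentially"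
    using weight_sum_at_top[OF b_nonneg b_le_half] by (simp add: W_def[abs_def])
  have Wpos: "eventually (\<lambda>n. 0 < W n) sequentially"
    using W by (simp add: filterlim_at_top_dense)
  have Winv: "(\<lambda>n. 1 / W n) \<longlonglongrightarrow> 0"
    using tendsto_divide_0[OF tendsto_const filterlim_at_top_imp_at_infinity[OF W]] .
  have Ces: "(\<lambda>n. (\<Sum>k=1..<n. weight b k * x k) / W n) \<longlonglongrightarrow> l" if "x \<longlonglongrightarrow> l" for x l
    using weighted_Cesaro[OF weight_nonneg weight_sum_at_top[OF b_nonneg b_le_half] that]
    by (simp add: W_def)
  have "(\<lambda>n. C 1 * (1 / W n) + (\<Sum>k=1..<n. weight b k * (C (Suc k) - C k * (1 + b / real k)\<^sup>2)) / W n)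
      \<longlonglongrightarrow> C 1 * 0 + L"
    by (intro tendsto_intros Winv Ces C)
  moreover have "eventually (\<lambda>n. C 1 * (1 / W n) + (\<Sum>k=1..<n. weight b k * (C (Suc k) - C k * (1 + b / real k)\<^sup>2)) / W n
      = q n / W n) sequentially"
    using eventually_ge_at_top[of 1]
    by eventually_elim (simp add: q_def scale_eq_weighted_sum[OF b_nonneg] add_divide_distrib)
  ultimately have qW: "(\<lambda>n. q n / W n) \<longlonglongrightarrow> L"
    by (simp add: Lim_transform_eventually)
  have qpos: "eventually (\<lambda>n. 0 < q n) sequentially"
    using order_tendstoD(1)[OF qW L] Wpos by eventually_elim (simp add: zero_less_divide_iff)
  have theta2: "eventually (\<lambda>n. t\<^sup>2 / (q n / W n) = (\<theta> n)\<^sup>2 * W n) sequentially"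
    using qpos
  proof eventually_elim
    case (elim n)
    have "growth b n \<ge> 1" by (rule growth_ge_1[OF b_nonneg])
    then have "C n > 0" using elim by (auto simp: q_def zero_less_divide_iff)
    then show ?case by (simp add: \<theta>_def q_def power_mult_distrib power_divide)
  qed
  have "(\<lambda>n. t\<^sup>2 / (q n / W n)) \<longlonglongrightarrow> t\<^sup>2 / L"
    using L by (intro tendsto_intros qW) auto
  from Lim_transform_eventually[OF this theta2] have tW: "(\<lambda>n. (\<theta> n)\<^sup>2 * W n) \<longlonglongrightarrow> t\<^sup>2 / L" .
  have "(\<lambda>n. ((\<theta> n)\<^sup>2 * W n) * (1 / W n)) \<longlonglongrightarrow> t\<^sup>2 / L * 0"
    by (intro tendsto_mult tW Winv)
  moreover have "eventually (\<lambda>n. ((\<theta> n)\<^sup>2 * W n) * (1 / W n) = (\<theta> n)\<^sup>2) sequentially"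
    using Wpos by eventually_elim simp
  ultimately have "(\<lambda>n. (\<theta> n)\<^sup>2) \<longlonglongrightarrow> 0"
    by (simp add: Lim_transform_eventually)
  from tendsto_real_sqrt[OF this] have t0: "(\<lambda>n. \<bar>\<theta> n\<bar>) \<longlonglongrightarrow> 0" by simp
  then have t0': "\<theta> \<longlonglongrightarrow> 0" by (rule tendsto_rabs_zero_cancel)

  \<comment> \<open>The accumulated error is \<open>\<theta>\<^sup>2 W\<^sub>n\<close>, which is bounded, times a null sequence.\<close>
  define R where "R n = (\<Sum>k=1..<n. weight b k * ((\<theta> n)\<^sup>2 / 2 * drift_error k + (\<bar>\<theta> n\<bar> ^ 3 + \<theta> n ^ 4)))" for n
  have "(\<lambda>n. ((\<theta> n)\<^sup>2 * W n) * (1 / 2 * ((\<Sum>k=1..<n. weight b k * drift_error k) / W n) + \<bar>\<theta> n\<bar> + \<bar>\<theta> n\<bar>\<^sup>2))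
      \<longlonglongrightarrow> t\<^sup>2 / L * (1 / 2 * 0 + 0 + 0\<^sup>2)"
    by (intro tendsto_intros tW Ces drift_error_tendsto_0 t0)
  moreover have "eventually (\<lambda>n. ((\<theta> n)\<^sup>2 * W n) * (1 / 2 * ((\<Sum>k=1..<n. weight b k * drift_error k) / W n) + \<bar>\<theta> n\<bar> + \<bar>\<theta> n\<bar>\<^sup>2)
      = R n) sequentially"
    using Wpos
  proof eventually_elim
    case (elim n)
    have Rn: "R n = (\<theta> n)\<^sup>2 / 2 * (\<Sum>k=1..<n. weight b k * drift_error k) + (\<bar>\<theta> n\<bar> ^ 3 + \<theta> n ^ 4) * W n"
      by (simp add: R_def W_def distrib_left sum.distrib sum_distrib_left sum_distrib_right sum_divide_distrib algebra_simps)
    have pow: "\<bar>\<theta> n\<bar> ^ 3 = (\<theta> n)\<^sup>2 * \<bar>\<theta> n\<bar>" "\<theta> n ^ 4 = (\<theta> n)\<^sup>2 * \<bar>\<theta> n\<bar>\<^sup>2"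
      by (simp_all add: power3_eq_cube power4_eq_xxxx power2_eq_square)
    have alg: "T * w * (1 / 2 * (A / w) + r + r\<^sup>2) = T / 2 * A + (T * r + T * r\<^sup>2) * w"
      if "w > 0" for T A r w :: real
      using that by (simp add: algebra_simps)
    show ?case unfolding Rn pow by (rule alg[OF elim])
  qed
  ultimately have R0: "R \<longlonglongrightarrow> 0" by (simp add: Lim_transform_eventually)

  have "(\<lambda>n. of_real (exp (- ((\<theta> n)\<^sup>2 * W n * v / 2))) * \<psi> 1 (\<theta> n)) \<longlonglongrightarrow> of_real (exp (- (t\<^sup>2 / L * v / 2))) * 1"
    by (intro tendsto_intros tW \<psi>_1_tendsto t0') auto
  moreover have "(\<lambda>n. \<psi> n (\<theta> n / growth b n) - of_real (exp (- ((\<theta> n)\<^sup>2 * W n * v / 2))) * \<psi> 1 (\<theta> n)) \<longlonglongrightarrow> 0"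
  proof (rule Lim_null_comparison[OF _ R0])
    show "\<forall>\<^sub>F n in sequentially. cmod (\<psi> n (\<theta> n / growth b n) - of_real (exp (- ((\<theta> n)\<^sup>2 * W n * v / 2))) * \<psi> 1 (\<theta> n)) \<le> R n"
      using eventually_ge_at_top[of 1]
      by eventually_elim (use \<psi>_telescope in \<open>simp add: R_def W_def v_def\<close>)
  qed
  ultimately have "(\<lambda>n. \<psi> n (\<theta> n / growth b n)) \<longlonglongrightarrow> of_real (exp (- (t\<^sup>2 / L * v / 2)))"
    using tendsto_add by fastforce
  moreover have "char (distr M borel (\<lambda>\<omega>. dev n (S n \<omega>) / sqrt (C n))) t = \<psi> n (\<theta> n / growth b n)" for n
  proof -
    have "\<theta> n / growth b n = t / sqrt (C n)"
      using growth_ge_1[OF b_nonneg, of n] by (simp add: \<theta>_def)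
    then show ?thesis
      unfolding char_def \<psi>_def by (subst integral_distr) auto
  qed
  ultimately show "(\<lambda>n. char (distr M borel (\<lambda>\<omega>. dev n (S n \<omega>) / sqrt (C n))) t)
      \<longlonglongrightarrow> char (normal_law 0 (\<mu> * (1 - \<mu>) / L)) t"
    using v by (simp add: char_normal_law v_def mult.commute)
qed

end

section \<open>Averaging over the memory switch\<close>

text \<open>Independence factorises \<open>P(S\<^sub>i = s, Y\<^sub>i = y)\<close>, so the transition probabilities are averaged with
  weights \<open>1 - \<lambda>\<close> and \<open>\<lambda>\<close>. The transition hypothesis says nothing about pairs \<open>(s, y)\<close> of
  probability zero; these contribute zero to both sides.\<close>
lemma bsrd_marginal_step:
  assumes bsrd: "bsrd M X Y"
    and Y_bernoulli: "\<P>(\<omega> in M. Y i \<omega> = 1) = lam"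
    and i: "i \<ge> 1"
    and transition: "\<And>y. y \<in> {0, 1} \<Longrightarrow> \<P>(\<omega> in M. partial_sum X i \<omega> = s \<and> Y i \<omega> = y) > 0 \<Longrightarrow>
      transition_prob M X Y i s y = a + c * real y"
  shows "\<P>(\<omega> in M. partial_sum X i \<omega> = s \<and> X (Suc i) \<omega> = 1) =
    (a + lam * c) * \<P>(\<omega> in M. partial_sum X i \<omega> = s)"
proof -
  interpret bsrd M X Y by fact
  define P where "P = \<P>(\<omega> in M. partial_sum X i \<omega> = s)"
  have [measurable]: "Y i \<in> M \<rightarrow>\<^sub>M count_space UNIV" "partial_sum X i \<in> M \<rightarrow>\<^sub>M count_space UNIV"
    "X (Suc i) \<in> M \<rightarrow>\<^sub>M count_space UNIV"
    using Y_indep_S[OF i] X_measurable[of "Suc i"] by (auto dest: indep_var_rv1 indep_var_rv2)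
  have joint: "\<P>(\<omega> in M. partial_sum X i \<omega> = s \<and> Y i \<omega> = y) = \<P>(\<omega> in M. Y i \<omega> = y) * P" for y
    using indep_varD[OF Y_indep_S[OF i], of "{y}" "{s}"]
    by (simp add: P_def vimage_def Int_def conj_commute)
  have "1 = prob (space M)" by (simp add: prob_space)
  also have "space M = {\<omega> \<in> space M. Y i \<omega> = 0} \<union> {\<omega> \<in> space M. Y i \<omega> = 1}"
    using Y_range[OF i] by auto
  also have "prob \<dots> = \<P>(\<omega> in M. Y i \<omega> = 0) + \<P>(\<omega> in M. Y i \<omega> = 1)"
    by (intro finite_measure_Union) auto
  finally have Y0: "\<P>(\<omega> in M. Y i \<omega> = 0) = 1 - lam" using Y_bernoulli by simp
  define J where "J y = {\<omega> \<in> space M. X (Suc i) \<omega> = 1 \<and> partial_sum X i \<omega> = s \<and> Y i \<omega> = y}" for y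
  have J[measurable]: "J y \<in> events" for y unfolding J_def by measurable
  have cond: "prob (J y) = (a + c * real y) * \<P>(\<omega> in M. partial_sum X i \<omega> = s \<and> Y i \<omega> = y)"
    if y: "y \<in> {0, 1}" for y
  proof (cases "\<P>(\<omega> in M. partial_sum X i \<omega> = s \<and> Y i \<omega> = y) > 0")
    case True
    then show ?thesis
      using transition[OF y] by (simp add: transition_prob_def cond_prob_def J_def field_simps)
  next
    case False
    then have "\<P>(\<omega> in M. partial_sum X i \<omega> = s \<and> Y i \<omega> = y) = 0"
      by (simp add: zero_less_measure_iff)
    moreover have "prob (J y) \<le> \<P>(\<omega> in M. partial_sum X i \<omega> = s \<and> Y i \<omega> = y)"
      by (intro finite_measure_mono) (auto simp: J_def)
    ultimately show ?thesis by (simp add: measure_le_0_iff)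
  qed
  have "{\<omega> \<in> space M. partial_sum X i \<omega> = s \<and> X (Suc i) \<omega> = 1} = J 0 \<union> J 1"
    using Y_range[OF i] by (auto simp: J_def)
  then have "\<P>(\<omega> in M. partial_sum X i \<omega> = s \<and> X (Suc i) \<omega> = 1) = prob (J 0) + prob (J 1)"
    by (simp only:) (intro finite_measure_Union J, auto simp: J_def)
  also have "\<dots> = (a + lam * c) * P"
    using cond[of 0] cond[of 1] by (simp add: joint Y0 Y_bernoulli[simplified] algebra_simps)
  finally show ?thesis by (simp add: P_def)
qed

section \<open>The two regimes\<close>

theorem theorem3:
  fixes M :: "'a measure" and X Y :: "nat \<Rightarrow> 'a \<Rightarrow> nat" and \<alpha>\<^sub>0 \<beta> lam :: real
  assumes bsrd: "bsrd M X Y"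
    and lam: "0 \<le> lam" "lam \<le> 1"
    and Y_bernoulli: "\<And>i. i \<ge> 1 \<Longrightarrow> \<P>(\<omega> in M. Y i \<omega> = 1) = lam"
    and beta: "0 \<le> \<beta>" "\<beta> \<le> 1"
    and alpha: "\<alpha>\<^sub>0 = \<P>(\<omega> in M. X 1 \<omega> = 1)"
    and transition: "\<And>i s y. i \<ge> 1 \<Longrightarrow> s \<le> i \<Longrightarrow> y \<in> {0, 1} \<Longrightarrow>
      \<P>(\<omega> in M. partial_sum X i \<omega> = s \<and> Y i \<omega> = y) > 0 \<Longrightarrow>
      transition_prob M X Y i s y = (1 - \<beta>) * \<alpha>\<^sub>0 + \<beta> * real y * (real s / real i)"
  shows "(\<beta> * lam < 1 / 2 \<longrightarrow>
      weak_conv_m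
        (\<lambda>n. distr M borel (\<lambda>\<omega>. 1 / sqrt (real n) *
           (real (partial_sum X n \<omega>) - real n * \<alpha>\<^sub>0 * (1 - \<beta>) / (1 - \<beta> * lam))))
        (normal_law 0
           (\<alpha>\<^sub>0 * (1 - \<alpha>\<^sub>0 - \<beta> * (lam - \<alpha>\<^sub>0)) * (1 - \<beta>) / ((1 - 2 * \<beta> * lam) * (1 - \<beta> * lam)\<^sup>2))))
    \<and> (\<beta> * lam = 1 / 2 \<longrightarrow>
      weak_conv_m
        (\<lambda>n. distr M borel (\<lambda>\<omega>.
           (real (partial_sum X n \<omega>) - 2 * real n * \<alpha>\<^sub>0 * (1 - \<beta>)) / sqrt (real n * ln (real n))))
        (normal_law 0 (4 * \<alpha>\<^sub>0 * (1 / 2 - \<alpha>\<^sub>0 * (1 - \<beta>)) * (1 - \<beta>))))"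
proof -
  interpret bsrd M X Y by (rule bsrd)
  define a where "a = (1 - \<beta>) * \<alpha>\<^sub>0"
  define b where "b = \<beta> * lam"
  have b0: "0 \<le> b" using lam beta by (simp add: b_def)
  have walk: "reinforced_Bernoulli M X a b" if "b \<le> 1 / 2"
  proof unfold_locales
    show "0 \<le> a" "0 \<le> b" "b \<le> 1 / 2"
      using b0 that beta alpha by (auto simp: a_def)
    have "\<alpha>\<^sub>0 \<le> 1" using alpha by simp
    then have "a \<le> (1 - \<beta>) * 1" "b \<le> \<beta> * 1"
      using beta lam unfolding a_def b_def by (intro mult_left_mono; simp)+
    then show "a + b \<le> 1" by simp
    fix i s :: nat assume i: "i \<ge> 1" "s \<le> i"
    have "\<P>(\<omega> in M. partial_sum X i \<omega> = s \<and> X (Suc i) \<omega> = 1) =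
       (a + lam * (\<beta> * (real s / real i))) * \<P>(\<omega> in M. partial_sum X i \<omega> = s)"
      using transition[OF i] by (intro bsrd_marginal_step[OF bsrd Y_bernoulli[OF i(1)] i(1)]) (auto simp: a_def)
    then show "\<P>(\<omega> in M. partial_sum X i \<omega> = s \<and> X (Suc i) \<omega> = 1) =
       (a + b * real s / real i) * \<P>(\<omega> in M. partial_sum X i \<omega> = s)"
      by (simp add: b_def mult_ac)
  qed (use X_measurable X_range in auto)
  show ?thesis
  proof (intro conjI impI)
    assume "\<beta> * lam < 1 / 2"
    then have b: "b < 1 / 2" by (simp add: b_def)
    interpret reinforced_Bernoulli M X a b using b by (intro walk) simp
    have "(\<lambda>k. real (Suc k) - real k * (1 + b / real k)\<^sup>2) \<longlonglongrightarrow> 1 - 2 * b"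
      by real_asymp
    from clt[OF _ this] b
    have "weak_conv_m (\<lambda>n. distr M borel (\<lambda>\<omega>. dev n (partial_sum X n \<omega>) / sqrt (real n)))
        (normal_law 0 (\<mu> * (1 - \<mu>) / (1 - 2 * b)))" by simp
    moreover have "\<mu> * (1 - \<mu>) / (1 - 2 * b) =
       \<alpha>\<^sub>0 * (1 - \<alpha>\<^sub>0 - \<beta> * (lam - \<alpha>\<^sub>0)) * (1 - \<beta>) / ((1 - 2 * \<beta> * lam) * (1 - \<beta> * lam)\<^sup>2)"
    proof -
      have "1 - \<mu> = (1 - b - a) / (1 - b)" using b by (simp add: \<mu>_def field_simps)
      then have "\<mu> * (1 - \<mu>) / (1 - 2 * b) = (a * (1 - b - a)) / ((1 - 2 * b) * (1 - b)\<^sup>2)"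
        by (simp add: \<mu>_def power2_eq_square mult.commute)
      then show ?thesis by (simp add: a_def b_def algebra_simps)
    qed
    moreover have "1 / sqrt (real n) * (real (partial_sum X n \<omega>) - real n * \<alpha>\<^sub>0 * (1 - \<beta>) / (1 - \<beta> * lam))
        = dev n (partial_sum X n \<omega>) / sqrt (real n)" for n \<omega>
      unfolding dev_def \<mu>_def by (simp add: a_def b_def mult_ac)
    ultimately show "weak_conv_m
        (\<lambda>n. distr M borel (\<lambda>\<omega>. 1 / sqrt (real n) *
           (real (partial_sum X n \<omega>) - real n * \<alpha>\<^sub>0 * (1 - \<beta>) / (1 - \<beta> * lam))))
        (normal_law 0
           (\<alpha>\<^sub>0 * (1 - \<alpha>\<^sub>0 - \<beta> * (lam - \<alpha>\<^sub>0)) * (1 - \<beta>) / ((1 - 2 * \<beta> * lam) * (1 - \<beta> * lam)\<^sup>2)))"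
      by (simp only:)
  next
    assume "\<beta> * lam = 1 / 2"
    then have b: "b = 1 / 2" by (simp add: b_def)
    interpret reinforced_Bernoulli M X a b using b by (intro walk) simp
    \<comment> \<open>The terms of order \<open>ln k\<close> cancel exactly because \<open>2 b = 1\<close>.\<close>
    have "(\<lambda>k. real (Suc k) * ln (real (Suc k)) - real k * ln (real k) * (1 + (1 / 2) / real k)\<^sup>2) \<longlonglongrightarrow> 1"
      by real_asymp
    then have "(\<lambda>k. real (Suc k) * ln (real (Suc k)) - real k * ln (real k) * (1 + b / real k)\<^sup>2) \<longlonglongrightarrow> 1"
      by (simp only: b)
    from clt[OF _ this]
    have "weak_conv_m (\<lambda>n. distr M borel (\<lambda>\<omega>. dev n (partial_sum X n \<omega>) / sqrt (real n * ln (real n))))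
        (normal_law 0 (\<mu> * (1 - \<mu>)))" by simp
    moreover have mu: "\<mu> = 2 * a" unfolding \<mu>_def by (simp add: b)
    moreover have "\<mu> * (1 - \<mu>) = 4 * \<alpha>\<^sub>0 * (1 / 2 - \<alpha>\<^sub>0 * (1 - \<beta>)) * (1 - \<beta>)"
      unfolding mu unfolding a_def by algebra
    moreover have "dev n (partial_sum X n \<omega>) = real (partial_sum X n \<omega>) - 2 * real n * \<alpha>\<^sub>0 * (1 - \<beta>)" for n \<omega>
      unfolding dev_def mu by (simp add: a_def mult_ac)
    ultimately show "weak_conv_m
        (\<lambda>n. distr M borel (\<lambda>\<omega>.
           (real (partial_sum X n \<omega>) - 2 * real n * \<alpha>\<^sub>0 * (1 - \<beta>)) / sqrt (real n * ln (real n))))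
        (normal_law 0 (4 * \<alpha>\<^sub>0 * (1 / 2 - \<alpha>\<^sub>0 * (1 - \<beta>)) * (1 - \<beta>)))"
      by (simp only:)
  qed
qed

end
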